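(* Every coded system is relatively mixing; that is, for every coded system $X$ with shift map $\sigma$ there is a regular periodic decomposition $\{D_0,\dots,D_{n-1}\}$ of $X$ such that $(D_i,\sigma^n)$ is topologically mixing for every $0\le i<n$.
   Context: Let $\mathcal A$ be a finite alphabet with at least two elements, let $\mathcal A^{\mathbb Z}$ carry the product topology, and let $\sigma$ be the shift map. A coded system is a closed shift-invariant set $X\subset\mathcal A^{\mathbb Z}$ which is the closure in $\mathcal A^{\mathbb Z}$ of the set of label sequences of bi-infinite paths in some irreducible directed graph with at most countably many vertices and edges, whose edges are labeled by symbols of $\mathcal A$ (irreducible: every ordered pair of vertices is joined by a path). A set is regular closed if it is the closure of its interior. A regular periodic decomposition of $X$ of length $n\ge1$ (for a continuous map $T\colon X\to X$, here $T=\sigma|_X$) is a finite cover $\{D_0,\dots,D_{n-1}\}$ of $X$ by non-empty regular closed subsets of $X$ with pairwise disjoint interiors (interiors taken in $X$) such that $T(D_{i-1})\subseteq D_{i \bmod n}$ for each $1\le i\le n$. The system $(D_i,\sigma^n)$ is topologically mixing if for all non-empty relatively open $U,V\subset D_i$ there is $M$ such that $\sigma^{nm}(U)\cap V\neq\emptyset$ for all $m>M$. *)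

theory Defs
  imports "HOL-Analysis.Analysis" "Graph_Theory.Digraph_Component"
begin

section \<open>The full shift\<close>

definition full_shift :: "'a set \<Rightarrow> (int \<Rightarrow> 'a) topology" where
  "full_shift A = product_topology (\<lambda>_. discrete_topology A) UNIV"

definition shift :: "(int \<Rightarrow> 'a) \<Rightarrow> int \<Rightarrow> 'a" where
  "shift x = (\<lambda>i. x (i + 1))"

lemma topspace_full_shift: "topspace (full_shift A) = {x. range x \<subseteq> A}"
  by (auto simp: full_shift_def PiE_def Pi_def)

lemma homeomorphic_map_shift: "homeomorphic_map (full_shift A) (full_shift A) shift"
proof -
  have c: "continuous_map (full_shift A) (full_shift A) (\<lambda>x i. x (i + k))" for k :: int
    unfolding full_shift_def
    by (auto simp: continuous_map_componentwise_UNIV intro: continuous_map_product_projection)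
  have "homeomorphic_maps (full_shift A) (full_shift A) shift (\<lambda>x i. x (i + (- 1)))"
    using c[of 1] c[of "- 1"] by (auto simp: homeomorphic_maps_def shift_def[abs_def])
  then show ?thesis
    by (rule homeomorphic_maps_imp_map)
qed


section \<open>Coded systems\<close>

text \<open>
  Arcs are objects in their own right, so loops and parallel arcs (with equal or different
  labels) are allowed.
\<close>

definition biinfinite_path :: "('v, 'e) pre_digraph \<Rightarrow> (int \<Rightarrow> 'e) \<Rightarrow> bool" where
  "biinfinite_path G p \<longleftrightarrow>
     range p \<subseteq> arcs G \<and> (\<forall>i. head G (p i) = tail G (p (i + 1)))"

definition label_sequences :: "('v, 'e) pre_digraph \<Rightarrow> ('e \<Rightarrow> 'a) \<Rightarrow> (int \<Rightarrow> 'a) set" where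
  "label_sequences G lab = {lab \<circ> p | p. biinfinite_path G p}"

definition countable_irreducible_labeled_graph ::
    "'a set \<Rightarrow> ('v, 'e) pre_digraph \<Rightarrow> ('e \<Rightarrow> 'a) \<Rightarrow> bool" where
  "countable_irreducible_labeled_graph A G lab \<longleftrightarrow>
     wf_digraph G \<and> countable (verts G) \<and> countable (arcs G) \<and>
     strongly_connected G \<and> lab ` arcs G \<subseteq> A"

text \<open>
  Vertices and arcs are taken from \<^typ>\<open>nat\<close>, which costs no generality: see
  \<open>coded_systemI\<close> below.  Since \<^const>\<open>strongly_connected\<close> admits paths of length 0, a single
  vertex without arcs satisfies it; \<^prop>\<open>X \<noteq> {}\<close> rules out exactly this graph, whose
  coded set is empty and has no regular periodic decomposition.
\<close>

definition coded_system :: "'a set \<Rightarrow> (int \<Rightarrow> 'a) set \<Rightarrow> bool" where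
  "coded_system A X \<longleftrightarrow>
     X \<noteq> {} \<and>
     (\<exists>(G :: (nat, nat) pre_digraph) lab.
        countable_irreducible_labeled_graph A G lab \<and>
        X = full_shift A closure_of label_sequences G lab)"

lemma coded_systemI:
  fixes G :: "('v, 'e) pre_digraph"
  assumes G: "countable_irreducible_labeled_graph A G lab"
    and X: "X = full_shift A closure_of label_sequences G lab" "X \<noteq> {}"
  shows "coded_system A X"
proof -
  define f where "f = to_nat_on (verts G)"
  define g where "g = to_nat_on (arcs G)"
  define h where "h = inv_into (arcs G) g"
  interpret wf_digraph G
    using G by (simp add: countable_irreducible_labeled_graph_def)
  have f: "inj_on f (verts G)" and g: "inj_on g (arcs G)"
    using G by (auto simp: countable_irreducible_labeled_graph_def f_def g_def)
  have hg: "h (g e) = e" if "e \<in> arcs G" for e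
    using that g by (simp add: h_def)
  define H :: "(nat, nat) pre_digraph" where
    "H = \<lparr>verts = f ` verts G, arcs = g ` arcs G,
          tail = (\<lambda>e. f (tail G (h e))), head = (\<lambda>e. f (head G (h e)))\<rparr>"
  have H: "verts H = f ` verts G" "arcs H = g ` arcs G"
    "\<And>e. tail H e = f (tail G (h e))" "\<And>e. head H e = f (head G (h e))"
    by (simp_all add: H_def)
  have wf: "wf_digraph H"
    by unfold_locales (auto simp: H hg)
  have reach: "f u \<rightarrow>\<^sup>*\<^bsub>H\<^esub> f v" if "u \<rightarrow>\<^sup>*\<^bsub>G\<^esub> v" for u v
    using that unfolding reachable_def
  proof (induction rule: rtrancl_on_induct)
    case base
    then show ?case by (simp add: H)
  next
    case (step v w)
    from step obtain e where e: "e \<in> arcs G" "tail G e = v" "head G e = w"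
      by (auto simp: arcs_ends_def arc_to_ends_def)
    then have "(f v, f w) \<in> arcs_ends H"
      by (force simp: arcs_ends_def arc_to_ends_def H hg)
    with step show ?case
      by (auto simp: H intro: rtrancl_on.rtrancl_on_into_rtrancl_on)
  qed
  have lab: "countable_irreducible_labeled_graph A H (lab \<circ> h)"
    using G wf reach
    by (auto simp: countable_irreducible_labeled_graph_def strongly_connected_def H hg)
  have "label_sequences H (lab \<circ> h) = label_sequences G lab"
  proof (intro equalityI subsetI)
    fix x assume "x \<in> label_sequences H (lab \<circ> h)"
    then obtain q where q: "biinfinite_path H q" "x = lab \<circ> h \<circ> q"
      by (auto simp: label_sequences_def)
    have m: "h (q i) \<in> arcs G" for i
    proof -
      have "q i \<in> g ` arcs G"
        using q(1) by (auto simp: biinfinite_path_def H)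
      then show ?thesis by (auto simp: hg)
    qed
    then have "biinfinite_path G (h \<circ> q)"
      using q(1) f by (auto simp: biinfinite_path_def H inj_on_eq_iff)
    then show "x \<in> label_sequences G lab"
      using q(2) by (auto simp: label_sequences_def comp_assoc)
  next
    fix x assume "x \<in> label_sequences G lab"
    then obtain p where p: "biinfinite_path G p" "x = lab \<circ> p"
      by (auto simp: label_sequences_def)
    have m: "p i \<in> arcs G" for i
      using p(1) by (auto simp: biinfinite_path_def)
    then have "biinfinite_path H (g \<circ> p)" "x = (lab \<circ> h) \<circ> (g \<circ> p)"
      using p by (auto simp: biinfinite_path_def H hg fun_eq_iff)
    then show "x \<in> label_sequences H (lab \<circ> h)"
      by (auto simp: label_sequences_def)
  qed
  with lab X show ?thesis
    unfolding coded_system_def by metis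
qed

lemma coded_system_closed: "coded_system A X \<Longrightarrow> closedin (full_shift A) X"
  by (auto simp: coded_system_def)

lemma coded_system_shift_invariant:
  assumes "coded_system A X"
  shows "shift ` X = X"
proof -
  obtain G :: "(nat, nat) pre_digraph" and lab where
    G: "countable_irreducible_labeled_graph A G lab" and
    X: "X = full_shift A closure_of label_sequences G lab"
    using assms by (auto simp: coded_system_def)
  have sub: "label_sequences G lab \<subseteq> topspace (full_shift A)"
    using G
    by (force simp: label_sequences_def topspace_full_shift biinfinite_path_def
        countable_irreducible_labeled_graph_def)
  have "shift ` label_sequences G lab = label_sequences G lab"
  proof (intro equalityI subsetI)
    fix x assume "x \<in> shift ` label_sequences G lab"
    then obtain p where p: "biinfinite_path G p" "x = shift (lab \<circ> p)"
      by (auto simp: label_sequences_def)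
    then have "biinfinite_path G (shift p)" "x = lab \<circ> shift p"
      by (auto simp: biinfinite_path_def shift_def)
    then show "x \<in> label_sequences G lab"
      by (auto simp: label_sequences_def)
  next
    fix x assume "x \<in> label_sequences G lab"
    then obtain p where p: "biinfinite_path G p" "x = lab \<circ> p"
      by (auto simp: label_sequences_def)
    define q where "q = (\<lambda>i. p (i - 1))"
    have "head G (q i) = tail G (q (i + 1))" for i
    proof -
      have "head G (p (i - 1)) = tail G (p (i - 1 + 1))"
        using p(1) unfolding biinfinite_path_def by blast
      then show ?thesis by (simp add: q_def)
    qed
    then have "biinfinite_path G q"
      using p(1) by (auto simp: biinfinite_path_def q_def)
    moreover have "x = shift (lab \<circ> q)"
      using p(2) by (auto simp: shift_def q_def)
    ultimately show "x \<in> shift ` label_sequences G lab"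
      by (auto simp: label_sequences_def)
  qed
  then show ?thesis
    using homeomorphic_map_closure_of[OF homeomorphic_map_shift sub] X by simp
qed


section \<open>Relative mixing\<close>

definition regular_closedin :: "'x topology \<Rightarrow> 'x set \<Rightarrow> bool" where
  "regular_closedin Y D \<longleftrightarrow> D = Y closure_of (Y interior_of D)"

definition regular_periodic_decomposition ::
    "'x topology \<Rightarrow> ('x \<Rightarrow> 'x) \<Rightarrow> nat \<Rightarrow> (nat \<Rightarrow> 'x set) \<Rightarrow> bool" where
  "regular_periodic_decomposition Y T n D \<longleftrightarrow>
     n \<ge> 1 \<and>
     (\<Union>i<n. D i) = topspace Y \<and>
     (\<forall>i<n. D i \<noteq> {} \<and> regular_closedin Y (D i)) \<and>
     (\<forall>i<n. \<forall>j<n. i \<noteq> j \<longrightarrow> Y interior_of D i \<inter> Y interior_of D j = {}) \<and>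
     (\<forall>i\<in>{1..n}. T ` D (i - 1) \<subseteq> D (i mod n))"

definition topologically_mixing :: "'x topology \<Rightarrow> ('x \<Rightarrow> 'x) \<Rightarrow> bool" where
  "topologically_mixing Y T \<longleftrightarrow>
     (\<forall>U V. openin Y U \<and> U \<noteq> {} \<and> openin Y V \<and> V \<noteq> {} \<longrightarrow>
        (\<exists>M. \<forall>m>M. (T ^^ m) ` U \<inter> V \<noteq> {}))"

definition relatively_mixing :: "'x topology \<Rightarrow> ('x \<Rightarrow> 'x) \<Rightarrow> bool" where
  "relatively_mixing Y T \<longleftrightarrow>
     (\<exists>n D. regular_periodic_decomposition Y T n D \<and>
        (\<forall>i<n. topologically_mixing (subtopology Y (D i)) (T ^^ n)))"

end

(* Let d be the gcd of the lengths of closed walks at a vertex v.  The bi-infinite paths split into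
   d phases, according to the distance mod d from v to the vertex at time 0.  Two paths of the same
   phase can be spliced after every sufficiently long waiting time divisible by d, so the closures
   C_0, ..., C_{d-1} of the label sequences of the phases are mixing under the d-th power of the
   shift, and the shift permutes them cyclically.  They may overlap, or even coincide: labels need
   not determine phases.  But a mixing C_i having a nonempty relatively open piece inside the
   invariant set C_j is contained in C_j, and then C_i = C_j because the permutation is cyclic.
   Hence distinct C_i meet in nowhere dense sets, and with n the least positive number such that
   C_n = C_0, the sets C_0, ..., C_{n-1} form the desired decomposition. *)

theory Submission
  imports Defs "HOL-Number_Theory.Cong"
begin

section \<open>Topological dynamics of closed mixing sets permuted cyclically by a map\<close>

section \<open>Periodic covers by mixing sets\<close>

text \<open>Stated for an arbitrary family so that it serves for the sets of a cyclic cover, for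
  phases before taking closures, and for constant families, where it says that iterates of a
  surjection are surjective.\<close>

lemma funpow_image_eq_shifted:
  fixes C :: "nat \<Rightarrow> 'x set"
  assumes "\<And>i. T ` C i = C (Suc i)"
  shows "(T ^^ k) ` C i = C (i + k)"
proof (induction k)
  case (Suc k)
  have "(T ^^ Suc k) ` C i = T ` ((T ^^ k) ` C i)"
    by (simp add: image_comp)
  then show ?case using Suc assms by simp
qed simp

lemma continuous_map_funpow:
  assumes "continuous_map Y Y T"
  shows "continuous_map Y Y (T ^^ k)"
proof (induction k)
  case (Suc k)
  then show ?case using continuous_map_compose[OF Suc assms] by (simp add: o_def)
qed (simp add: id_def)

text \<open>Write a large time as \<open>j = k * q + r\<close> with \<open>r < k\<close>. The
  preimages of \<open>V\<close> under the powers \<open>T ^^ r\<close> are open, and non-empty by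
  surjectivity; being finitely many, they share one mixing threshold for \<open>T ^^ k\<close>. The
  lemma is used to pass from the given period to the least one.\<close>

lemma topologically_mixing_root:
  assumes cont: "continuous_map Y Y T" and surj: "T ` topspace Y = topspace Y"
    and k: "k > 0" and mix: "topologically_mixing Y (T ^^ k)"
  shows "topologically_mixing Y T"
  unfolding topologically_mixing_def
proof (intro allI impI, elim conjE)
  fix U V assume U: "openin Y U" "U \<noteq> {}" and V: "openin Y V" "V \<noteq> {}"
  define W where "W r = {x \<in> topspace Y. (T ^^ r) x \<in> V}" for r
  have "openin Y (W r)" for r
    unfolding W_def by (rule openin_continuous_map_preimage[OF continuous_map_funpow[OF cont] V(1)])
  moreover have "W r \<noteq> {}" for r
  proof -
    obtain y where y: "y \<in> V" "y \<in> topspace Y" using V openin_subset by blast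
    have "(T ^^ r) ` topspace Y = topspace Y"
      using funpow_image_eq_shifted[of T "\<lambda>_. topspace Y" r 0] surj by simp
    then show ?thesis using y unfolding W_def by force
  qed
  ultimately have "\<exists>M. \<forall>m>M. ((T ^^ k) ^^ m) ` U \<inter> W r \<noteq> {}" for r
    using mix U unfolding topologically_mixing_def by blast
  then obtain M where M: "\<And>r m. m > M r \<Longrightarrow> ((T ^^ k) ^^ m) ` U \<inter> W r \<noteq> {}" by metis
  define N where "N = Max (M ` {..<k})"
  have N: "M r \<le> N" if "r < k" for r using that unfolding N_def by auto
  \<comment> \<open>Beyond this bound the quotient \<open>j div k\<close> exceeds every threshold
    \<open>M r\<close> with \<open>r < k\<close>.\<close>
  have "(T ^^ j) ` U \<inter> V \<noteq> {}" if j: "j > (N + 1) * k" for j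
  proof -
    have "N + 1 \<le> j div k" using j k by (simp add: less_eq_div_iff_mult_less_eq)
    moreover have "M (j mod k) \<le> N" using N k by simp
    ultimately obtain u where u: "u \<in> U" "((T ^^ k) ^^ (j div k)) u \<in> W (j mod k)"
      using M[of "j mod k" "j div k"] by fastforce
    have "(T ^^ (j mod k)) (((T ^^ k) ^^ (j div k)) u) = (T ^^ j) u"
      by (metis funpow_add funpow_mult comp_apply mod_mult_div_eq)
    then show ?thesis using u unfolding W_def by force
  qed
  then show "\<exists>M. \<forall>m>M. (T ^^ m) ` U \<inter> V \<noteq> {}" by blast
qed

text \<open>Indices run over all naturals, so that cyclic index arithmetic is plain addition. The
  sets \<open>C i\<close> with \<open>i < p\<close> may coincide or overlap: \<open>p\<close> is a
  period of the family, not necessarily the least.\<close>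

locale mixing_cyclic_cover =
  fixes Y :: "'x topology" and T :: "'x \<Rightarrow> 'x" and p :: nat and C :: "nat \<Rightarrow> 'x set"
  assumes continuous: "continuous_map Y Y T"
    and period_pos: "p > 0"
    and closed: "closedin Y (C i)"
    and nonempty: "C i \<noteq> {}"
    and image: "T ` C i = C (Suc i)"
    and periodic: "C (i + p) = C i"
    and cover: "(\<Union>i<p. C i) = topspace Y"
    and mixing: "topologically_mixing (subtopology Y (C i)) (T ^^ p)"
begin

lemma periodic_mult: "C (i + p * m) = C i"
proof (induction m)
  case (Suc m)
  have "C (i + p * Suc m) = C ((i + p * m) + p)" by (simp add: algebra_simps)
  then show ?case using Suc periodic by metis
qed simp

lemma subset_shift:
  assumes "C i \<subseteq> C j"
  shows "C (i + k) \<subseteq> C (j + k)"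
  using image_mono[OF assms, of "T ^^ k"] funpow_image_eq_shifted[of T C, OF image] by simp

lemma eq_shift: "C i = C j \<Longrightarrow> C (i + k) = C (j + k)"
  using subset_shift by blast

text \<open>Applying powers of \<open>T\<close> to the inclusion gives an increasing chain along the
  indices \<open>i\<close>, \<open>i + d\<close>, \<open>i + 2 * d\<close>, and so on. After
  \<open>p\<close> steps it is back at \<open>C i\<close>, so all its members are equal.\<close>

lemma subset_imp_eq:
  assumes "C i \<subseteq> C j"
  shows "C i = C j"
proof -
  \<comment> \<open>The summand \<open>p * i\<close> leaves the set unchanged and keeps the natural
    subtraction from truncating when \<open>j < i\<close>.\<close>
  define d where "d = j + p * i - i"
  have "p * i \<ge> i" using period_pos by simp
  then have d: "i + d = j + p * i" unfolding d_def by linarith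
  then have Cd: "C (i + d) = C j" using periodic_mult by simp
  have step: "C (i + d) \<subseteq> C (i + d * Suc m)" for m
  proof (induction m)
    case (Suc m)
    have "C (i + d * Suc m) \<subseteq> C (i + d + d * Suc m)"
      using subset_shift[of i "i + d"] assms Cd by simp
    then show ?case using Suc by (simp add: algebra_simps)
  qed simp
  obtain q where q: "p = Suc q" using period_pos gr0_conv_Suc by blast
  have "C (i + d) \<subseteq> C (i + d * p)" using step q by simp
  also have "\<dots> = C i" using periodic_mult[of i d] by (simp add: mult.commute)
  finally show ?thesis using assms Cd by simp
qed

text \<open>If \<open>C i\<close> left \<open>C j\<close>, mixing would carry a point of the piece
  \<open>W \<inter> C i\<close> outside \<open>C j\<close>. But the piece lies in
  \<open>C j\<close>, which every power of \<open>T ^^ p\<close> maps onto itself.\<close>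

lemma open_piece_subset:
  assumes W: "openin Y W" "W \<inter> C i \<noteq> {}" "W \<inter> C i \<subseteq> C j"
  shows "C i = C j"
proof (rule subset_imp_eq, rule ccontr)
  assume "\<not> C i \<subseteq> C j"
  then have V: "(topspace Y - C j) \<inter> C i \<noteq> {}"
    using closedin_subset[OF closed] by blast
  have "openin (subtopology Y (C i)) (W \<inter> C i)"
    using W by (auto simp: openin_subtopology)
  moreover have "openin (subtopology Y (C i)) ((topspace Y - C j) \<inter> C i)"
    using closed by (auto simp: openin_subtopology)
  ultimately obtain M where
    "\<forall>m>M. ((T ^^ p) ^^ m) ` (W \<inter> C i) \<inter> ((topspace Y - C j) \<inter> C i) \<noteq> {}"
    using mixing[of i] W(2) V unfolding topologically_mixing_def by blast
  then have "((T ^^ p) ^^ Suc M) ` (W \<inter> C i) \<inter> ((topspace Y - C j) \<inter> C i) \<noteq> {}"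
    by blast
  moreover have "((T ^^ p) ^^ Suc M) ` C j = C j"
    using funpow_image_eq_shifted[of T C, OF image] periodic_mult[of j "Suc M"]
    by (simp only: funpow_mult)
  ultimately show False using W(3) by blast
qed

text \<open>Either the piece lies in one closed set \<open>C j\<close>, or removing
  \<open>C j\<close> leaves a smaller non-empty open piece covered by the remaining sets.\<close>

lemma open_piece_subset_Union:
  assumes "finite J" "openin Y W" "W \<inter> C i \<noteq> {}" "W \<inter> C i \<subseteq> (\<Union>j\<in>J. C j)"
  shows "\<exists>j\<in>J. C i = C j"
  using assms
proof (induction J arbitrary: W rule: finite_induct)
  case (insert j J)
  show ?case
  proof (cases "W \<inter> C i \<subseteq> C j")
    case True
    then show ?thesis using open_piece_subset insert.prems by blast
  next
    case False
    have "openin Y (W - C j)" using insert.prems closed by blast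
    moreover have "(W - C j) \<inter> C i \<noteq> {}" using False by blast
    moreover have "(W - C j) \<inter> C i \<subseteq> (\<Union>j\<in>J. C j)" using insert.prems by blast
    ultimately show ?thesis using insert.IH by blast
  qed
qed blast

theorem relatively_mixing: "relatively_mixing Y T"
proof -
  define n where "n = (LEAST n. n > 0 \<and> C n = C 0)"
  have Cp: "C p = C 0" using periodic[of 0] by simp
  have n: "n > 0" "C n = C 0"
    using LeastI[of "\<lambda>n. n > 0 \<and> C n = C 0" p] Cp period_pos unfolding n_def by auto
  have least: "n \<le> k" if "k > 0" "C k = C 0" for k
    using that unfolding n_def by (auto intro: Least_le)
  have n_mult: "C (i + n * m) = C i" for i m
  proof (induction m)
    case (Suc m)
    have "C (n + (i + n * m)) = C (0 + (i + n * m))" using eq_shift n(2) by blast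
    then show ?case using Suc by (simp add: algebra_simps)
  qed simp
  have Cmod: "C (i mod n) = C i" for i
    using n_mult[of "i mod n" "i div n"] by simp
  have less_neq: "C i \<noteq> C j" if "i < j" "j < n" for i j
  proof
    assume "C i = C j"
    \<comment> \<open>Moving index \<open>j\<close> up to \<open>n\<close> would make
      \<open>i + (n - j)\<close> a positive period smaller than \<open>n\<close>.\<close>
    then have "C (i + (n - j)) = C (j + (n - j))" by (rule eq_shift)
    then have "C (i + (n - j)) = C 0" using that n by simp
    then show False using least[of "i + (n - j)"] that by simp
  qed
  then have neq: "C i \<noteq> C j" if "i \<noteq> j" "i < n" "j < n" for i j
    using that by (metis linorder_neqE_nat)
  \<comment> \<open>The index \<open>p mod n\<close> gives the same set as index 0, and indices
    below \<open>n\<close> give distinct sets.\<close>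
  have dvd: "n dvd p"
    using neq[of "p mod n" 0] n Cp Cmod[of p] by (metis mod_less_divisor mod_0_imp_dvd)
  have cover_n: "(\<Union>i<n. C i) = topspace Y"
  proof
    show "(\<Union>i<n. C i) \<subseteq> topspace Y" using closedin_subset[OF closed] by blast
    have "C i \<subseteq> (\<Union>i<n. C i)" for i
      using Cmod[of i] mod_less_divisor[OF n(1), of i] by blast
    then show "topspace Y \<subseteq> (\<Union>i<n. C i)"
      unfolding cover[symmetric] by blast
  qed
  have regular: "regular_closedin Y (C i)" if i: "i < n" for i
  proof -
    \<comment> \<open>The points lying in no other member of the cover form an open subset of
      \<open>C i\<close>. It is dense in \<open>C i\<close>, since otherwise the other members would
      cover an open piece of \<open>C i\<close>.\<close>
    define W where "W = topspace Y - (\<Union>j\<in>{..<n} - {i}. C j)"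
    have W: "openin Y W"
      unfolding W_def by (intro openin_diff openin_topspace closedin_Union) (auto simp: closed)
    have "W \<subseteq> C i"
    proof
      fix x assume "x \<in> W"
      then obtain k where "k < n" "x \<in> C k" "x \<notin> (\<Union>j\<in>{..<n} - {i}. C j)"
        using cover_n unfolding W_def by blast
      then show "x \<in> C i" by (cases "k = i") auto
    qed
    then have WI: "W \<subseteq> Y interior_of C i" using W by (rule interior_of_maximal)
    have "C i \<subseteq> Y closure_of W"
    proof
      fix x assume x: "x \<in> C i"
      have "\<exists>y. y \<in> W \<and> y \<in> O'" if O': "x \<in> O'" "openin Y O'" for O'
      proof (rule ccontr)
        assume "\<not> ?thesis"
        then have "O' \<inter> C i \<subseteq> (\<Union>j\<in>{..<n} - {i}. C j)"
          using openin_subset[OF O'(2)] unfolding W_def by blast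
        then have "\<exists>j\<in>{..<n} - {i}. C i = C j"
          using open_piece_subset_Union[of "{..<n} - {i}" O' i] O' x by blast
        then show False using neq i by blast
      qed
      then show "x \<in> Y closure_of W"
        using x closedin_subset[OF closed] unfolding in_closure_of by blast
    qed
    also have "\<dots> \<subseteq> Y closure_of (Y interior_of C i)" by (rule closure_of_mono[OF WI])
    finally have "C i \<subseteq> Y closure_of (Y interior_of C i)" .
    moreover have "Y closure_of (Y interior_of C i) \<subseteq> C i"
      by (rule closure_of_minimal[OF interior_of_subset closed])
    ultimately show ?thesis unfolding regular_closedin_def by blast
  qed
  have disjoint: "Y interior_of C i \<inter> Y interior_of C j = {}"
    if "i \<noteq> j" "i < n" "j < n" for i j
  proof (rule ccontr)
    assume ne: "Y interior_of C i \<inter> Y interior_of C j \<noteq> {}"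
    have "openin Y (Y interior_of C i \<inter> Y interior_of C j)"
      by (intro openin_Int openin_interior_of)
    moreover have "Y interior_of C i \<subseteq> C i" "Y interior_of C j \<subseteq> C j"
      by (auto simp: interior_of_subset)
    ultimately have "C i = C j"
      using ne open_piece_subset[of "Y interior_of C i \<inter> Y interior_of C j" i j] by blast
    then show False using neq that by blast
  qed
  have "regular_periodic_decomposition Y T n C"
    unfolding regular_periodic_decomposition_def
  proof (intro conjI allI impI ballI)
    fix i assume "i \<in> {1..n}"
    then have "T ` C (i - 1) = C i" using image[of "i - 1"] by simp
    then show "T ` C (i - 1) \<subseteq> C (i mod n)" using Cmod by simp
  qed (use n cover_n nonempty regular disjoint in auto)
  moreover have "topologically_mixing (subtopology Y (C i)) (T ^^ n)" for i
  proof (rule topologically_mixing_root)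
    have im: "(T ^^ n) ` C i = C i"
      using funpow_image_eq_shifted[of T C, OF image] n_mult[of i 1] by simp
    have "C i \<subseteq> topspace Y" by (rule closedin_subset[OF closed])
    then have top: "topspace (subtopology Y (C i)) = C i" by auto
    show "continuous_map (subtopology Y (C i)) (subtopology Y (C i)) (T ^^ n)"
      using continuous_map_funpow[OF continuous] im top
      by (auto simp: continuous_map_in_subtopology intro: continuous_map_from_subtopology)
    show "(T ^^ n) ` topspace (subtopology Y (C i)) = topspace (subtopology Y (C i))"
      using im top by simp
    show "p div n > 0" using dvd n period_pos by (auto simp: div_greater_zero_iff dvd_imp_le)
    show "topologically_mixing (subtopology Y (C i)) ((T ^^ n) ^^ (p div n))"
      using mixing[of i] dvd by (simp add: funpow_mult)
  qed
  ultimately show ?thesis unfolding relatively_mixing_def by blast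
qed

end

section \<open>Additive submonoids of the naturals and the multiples of their gcd\<close>

section \<open>Numerical semigroups\<close>

text \<open>Two elements \<open>b\<close> and \<open>b + d\<close> at the least positive distance
  suffice: a non-zero remainder modulo \<open>d\<close> would produce a smaller distance, and sums
  of copies of \<open>b\<close> and \<open>b + d\<close> reach every large multiple of
  \<open>d\<close>.\<close>

lemma submonoid_nat_eventually_multiples:
  fixes S :: "nat set"
  assumes zero: "0 \<in> S" and add: "\<And>a b. a \<in> S \<Longrightarrow> b \<in> S \<Longrightarrow> a + b \<in> S"
    and pos: "s0 \<in> S" "s0 > 0"
  obtains d M where "d > 0" "\<And>s. s \<in> S \<Longrightarrow> d dvd s" "\<And>m. m \<ge> M \<Longrightarrow> d * m \<in> S"
proof -
  have mult: "k * a \<in> S" if "a \<in> S" for a k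
    using that by (induction k) (auto intro: zero add)
  \<comment> \<open>The positive differences of elements of \<open>S\<close>; the least one is the gcd of \<open>S\<close>.\<close>
  let ?D = "\<lambda>d. d > 0 \<and> (\<exists>b\<in>S. b + d \<in> S)"
  define d where "d = (LEAST d. ?D d)"
  have "?D s0" using pos zero by force
  then have "?D d" unfolding d_def by (rule LeastI)
  then obtain b where d: "d > 0" and b: "b \<in> S" "b + d \<in> S" by blast
  have least: "d \<le> r" if "?D r" for r using that unfolding d_def by (rule Least_le)
  have dvd: "d dvd s" if s: "s \<in> S" for s
  proof (rule ccontr)
    assume nd: "\<not> d dvd s"
    define q where "q = s div d"
    \<comment> \<open>This exhibits \<open>s mod d\<close> as the difference of two elements of
      \<open>S\<close>, namely \<open>s + q * b\<close> and \<open>q * (b + d)\<close>.\<close>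
    have "q * (b + d) + s mod d = s + q * b"
      unfolding q_def by (simp add: algebra_simps)
    then have "q * (b + d) + s mod d \<in> S" using add[OF s mult[OF b(1)]] by simp
    then have "?D (s mod d)" using mult[OF b(2)] nd by (auto simp: mod_greater_zero_iff_not_dvd)
    then show False using least[of "s mod d"] mod_less_divisor[OF d, of s] by simp
  qed
  obtain t where t: "b = d * t" using dvd[OF b(1)] by blast
  \<comment> \<open>With \<open>m = t * q + r\<close> and \<open>r < t\<close>, the bound gives
    \<open>r < q\<close>, so that \<open>d * m\<close> is the sum of \<open>q - r\<close> copies of
    \<open>b\<close> and \<open>r\<close> copies of \<open>b + d\<close>.\<close>
  have "d * m \<in> S" if m: "m \<ge> t * t" for m
  proof (cases "t = 0")
    case True
    then show ?thesis using b t mult[of d m] by (simp add: mult.commute)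
  next
    case False
    define q r where "q = m div t" and "r = m mod t"
    have "r < t" using False unfolding r_def by simp
    moreover have "t \<le> q" using m False unfolding q_def by (simp add: less_eq_div_iff_mult_less_eq)
    ultimately obtain e where e: "q = r + e" using le_Suc_ex[of r q] by auto
    have "m = t * q + r" unfolding q_def r_def by simp
    then have "d * m = e * b + r * (b + d)" by (simp add: e t algebra_simps)
    then show ?thesis using add mult b by simp
  qed
  then show thesis using that d dvd by blast
qed

section \<open>Finite windows, finite walks and the gluing of bi-infinite paths\<close>

section \<open>Spliced paths\<close>

lemma funpow_shift: "(shift ^^ m) x = (\<lambda>i. x (i + int m))"
  by (induction m arbitrary: x) (auto simp: shift_def algebra_simps)

text \<open>A basic open set of the product restricts only finitely many coordinates, and
  \<open>N\<close> bounds their absolute values.\<close>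

lemma openin_full_shift_window:
  assumes "openin (full_shift A) U" "x \<in> U"
  obtains N :: nat where "\<And>z. range z \<subseteq> A \<Longrightarrow> (\<And>i. \<bar>i\<bar> \<le> int N \<Longrightarrow> z i = x i) \<Longrightarrow> z \<in> U"
proof -
  obtain B where B: "finite {i. B i \<noteq> A}" "x \<in> (\<Pi>\<^sub>E i\<in>UNIV. B i)" "(\<Pi>\<^sub>E i\<in>UNIV. B i) \<subseteq> U"
    using assms unfolding full_shift_def openin_product_topology_alt by auto
  have "\<exists>N::nat. \<forall>i\<in>{i. B i \<noteq> A}. \<bar>i\<bar> \<le> int N"
    using B(1)
  proof (intro exI ballI)
    fix i assume "i \<in> {i. B i \<noteq> A}"
    then have "nat \<bar>i\<bar> \<le> Max ((\<lambda>i. nat \<bar>i\<bar>) ` {i. B i \<noteq> A})"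
      using B(1) by (intro Max_ge) auto
    then show "\<bar>i\<bar> \<le> int (Max ((\<lambda>i. nat \<bar>i\<bar>) ` {i. B i \<noteq> A}))" by linarith
  qed
  then obtain N :: nat where N: "\<And>i. B i \<noteq> A \<Longrightarrow> \<bar>i\<bar> \<le> int N" by blast
  have "z \<in> U" if "range z \<subseteq> A" "\<And>i. \<bar>i\<bar> \<le> int N \<Longrightarrow> z i = x i" for z
  proof -
    have "z i \<in> B i" for i
      using that N[of i] B(2) by (cases "B i = A") (auto simp: PiE_def Pi_def)
    then show ?thesis using B(3) by auto
  qed
  then show thesis using that by blast
qed

context wf_digraph
begin

lemma awalk_nth_step:
  assumes "awalk u w v" "Suc k < length w"
  shows "head G (w ! k) = tail G (w ! Suc k)"
  using assms
proof (induction w arbitrary: u k)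
  case (Cons e w)
  then show ?case
    by (cases k; cases w) (auto simp: awalk_Cons_iff)
qed simp

lemma awalk_hd_tail: "awalk u w v \<Longrightarrow> w \<noteq> [] \<Longrightarrow> tail G (w ! 0) = u"
  by (cases w) (auto simp: awalk_Cons_iff)

lemma awalk_last_head: "awalk u w v \<Longrightarrow> w \<noteq> [] \<Longrightarrow> head G (w ! (length w - 1)) = v"
  by (induction w arbitrary: u) (auto simp: awalk_Cons_iff awalk_Nil_iff nth_Cons')

text \<open>The walk is the segment of \<open>k\<close> arcs beginning with \<open>p i\<close>. The
  vertex at a time is always the tail of the arc at that time, so \<open>k = 0\<close> gives the
  empty walk.\<close>

lemma biinfinite_path_awalk:
  assumes "biinfinite_path G p"
  shows "\<exists>w. awalk (tail G (p i)) w (tail G (p (i + int k))) \<and> length w = k"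
proof (induction k)
  case 0
  have "p i \<in> arcs G" using assms by (auto simp: biinfinite_path_def)
  then show ?case by (auto simp: awalk_Nil_iff)
next
  case (Suc k)
  then obtain w where w: "awalk (tail G (p i)) w (tail G (p (i + int k)))" "length w = k" by blast
  have "p (i + int k) \<in> arcs G" using assms by (auto simp: biinfinite_path_def)
  moreover have "head G (p (i + int k)) = tail G (p (i + int (Suc k)))"
    using assms unfolding biinfinite_path_def by (metis add.assoc of_nat_Suc add.commute)
  ultimately have "awalk (tail G (p i)) (w @ [p (i + int k)]) (tail G (p (i + int (Suc k))))"
    using awalk_appendI[OF w(1) arc_implies_awalk] by simp
  then show ?case using w(2) by (metis length_append_singleton)
qed

text \<open>The path \<open>z\<close> follows \<open>p\<close> strictly before time
  \<open>a\<close>, then runs through \<open>w\<close>, and then continues with \<open>q\<close>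
  from its time \<open>b\<close> on.\<close>

lemma biinfinite_path_splice:
  assumes p: "biinfinite_path G p" and q: "biinfinite_path G q"
    and w: "awalk (tail G (p a)) w (tail G (q b))"
  obtains z where "biinfinite_path G z" "\<And>i. i < a \<Longrightarrow> z i = p i"
    "\<And>j. j \<ge> 0 \<Longrightarrow> z (a + int (length w) + j) = q (b + j)"
proof -
  define l where "l = int (length w)"
  define z where "z i = (if i < a then p i else if i < a + l then w ! nat (i - a)
    else q (b + (i - a - l)))" for i
  have l0: "l \<ge> 0" "w = [] \<longleftrightarrow> l = 0" unfolding l_def by auto
  have arcs: "z i \<in> arcs G" for i
  proof -
    have "set w \<subseteq> arcs G" using w by auto
    then have "w ! nat (i - a) \<in> arcs G" if "a \<le> i" "i < a + l"
      using that unfolding l_def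
        by (metis add.commute int_nat_eq diff_ge_0_iff_ge diff_less_eq nth_mem of_nat_less_iff subsetD)
    then show ?thesis using p q unfolding z_def biinfinite_path_def by auto
  qed
  have pstep: "head G (p i) = tail G (p (i + 1))" and qstep: "head G (q i) = tail G (q (i + 1))" for i
    using p q unfolding biinfinite_path_def by auto
  \<comment> \<open>For empty \<open>w\<close> the arc \<open>z a\<close> is already
    \<open>q b\<close>; proving this junction separately spares that case distinction below.\<close>
  have tail_a: "tail G (z a) = tail G (p a)"
  proof (cases "w = []")
    case True
    then show ?thesis using w l0 unfolding z_def by (auto simp: awalk_Nil_iff)
  next
    case False
    then show ?thesis using awalk_hd_tail[OF w] l0 unfolding z_def by auto
  qed
  have step: "head G (z i) = tail G (z (i + 1))" for i
  proof -
    consider "i + 1 < a" | "i + 1 = a" | "a \<le> i" "i + 1 < a + l" | "a \<le> i" "i + 1 = a + l" | "a + l \<le> i" "a \<le> i"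
      using l0 by linarith
    then show ?thesis
    proof cases
      case 1
      then show ?thesis using pstep unfolding z_def by simp
    next
      case 2
      then have "z i = p i" unfolding z_def by simp
      then show ?thesis using tail_a pstep[of i] 2 by simp
    next
      case 3
      then have "nat (i + 1 - a) = Suc (nat (i - a))" "Suc (nat (i - a)) < length w"
        unfolding l_def by linarith+
      then show ?thesis using 3 awalk_nth_step[OF w] unfolding z_def by simp
    next
      case 4
      then have "nat (i - a) = length w - 1" "w \<noteq> []" unfolding l_def by auto
      then show ?thesis using 4 awalk_last_head[OF w] unfolding z_def by simp
    next
      case 5
      have "b + (i + 1 - a - l) = b + (i - a - l) + 1" by simp
      moreover have "z i = q (b + (i - a - l))" "z (i + 1) = q (b + (i + 1 - a - l))"
        using 5 l0 unfolding z_def by auto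
      ultimately show ?thesis using qstep[of "b + (i - a - l)"] by metis
    qed
  qed
  have "biinfinite_path G z" using arcs step unfolding biinfinite_path_def by auto
  moreover have "z i = p i" if "i < a" for i using that unfolding z_def by simp
  moreover have "z (a + int (length w) + j) = q (b + j)" if "j \<ge> 0" for j
    using that l0 unfolding z_def l_def by simp
  ultimately show thesis using that by blast
qed

end

section \<open>Return times and phases relative to a base vertex\<close>

section \<open>Coded systems\<close>

locale based_labeled_graph = wf_digraph G for G :: "('v, 'e) pre_digraph" +
  fixes A :: "'a set" and lab :: "'e \<Rightarrow> 'a" and v :: 'v
  assumes connected: "strongly_connected G"
    and labels: "lab ` arcs G \<subseteq> A"
    and base: "v \<in> verts G"
begin

lemma awalk_exists: "u \<in> verts G \<Longrightarrow> w \<in> verts G \<Longrightarrow> \<exists>q. awalk u q w"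
  using connected reachable_awalk unfolding strongly_connected_def by blast

definition return_times :: "nat set" where
  "return_times = {length w | w. awalk v w v}"

text \<open>The phase belongs to the path and not to its labels, so one sequence may occur in
  several phases. One walk from \<open>v\<close> is enough to fix the phase of a path as soon as
  \<open>d\<close> divides all return times.\<close>

definition phase_sequences :: "nat \<Rightarrow> nat \<Rightarrow> (int \<Rightarrow> 'a) set" where
  "phase_sequences d i = {lab \<circ> p | p. biinfinite_path G p \<and>
     (\<exists>w. awalk v w (tail G (p 0)) \<and> [length w = i] (mod d))}"

lemma return_times_zero: "0 \<in> return_times"
  using base unfolding return_times_def by (auto simp: awalk_Nil_iff)

lemma return_times_add:
  assumes "a \<in> return_times" "b \<in> return_times"
  shows "a + b \<in> return_times"
proof -
  obtain w w' where "awalk v w v" "awalk v w' v" "a = length w" "b = length w'"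
    using assms unfolding return_times_def by blast
  then have "awalk v (w @ w') v" "a + b = length (w @ w')" by auto
  then show ?thesis unfolding return_times_def by blast
qed

lemma path_vertex: "biinfinite_path G p \<Longrightarrow> tail G (p i) \<in> verts G"
  unfolding biinfinite_path_def by (meson rangeI subsetD tail_in_verts)

text \<open>A path supplies an arc, and a closed walk from \<open>v\<close> through that arc has
  positive length.\<close>

lemma return_times_positive:
  assumes "biinfinite_path G p"
  obtains s where "s \<in> return_times" "s > 0"
proof -
  obtain u where u: "awalk v u (tail G (p 0))"
    using awalk_exists base path_vertex[OF assms] by blast
  obtain w where w: "awalk (tail G (p 0)) w (tail G (p 1))" "length w = 1"
    using biinfinite_path_awalk[OF assms, of 0 1] by auto
  obtain r where r: "awalk (tail G (p 1)) r v"
    using awalk_exists base path_vertex[OF assms] by blast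
  have "awalk v (u @ w @ r) v" using u w r by (auto intro: awalk_appendI)
  then have "length (u @ w @ r) \<in> return_times" unfolding return_times_def by blast
  then show thesis using that w by auto
qed

lemma label_sequence_range: "biinfinite_path G p \<Longrightarrow> range (lab \<circ> p) \<subseteq> A"
  using labels unfolding biinfinite_path_def by auto

lemma phase_sequences_subset: "phase_sequences d i \<subseteq> topspace (full_shift A)"
  using label_sequence_range unfolding phase_sequences_def topspace_full_shift by blast

lemma phase_sequences_periodic: "phase_sequences d (i + d) = phase_sequences d i"
  unfolding phase_sequences_def by (simp add: cong_def)

lemma phase_sequences_cover:
  assumes "d > 0"
  shows "(\<Union>i<d. phase_sequences d i) = label_sequences G lab"
proof (intro equalityI subsetI)
  fix x assume "x \<in> label_sequences G lab"
  then obtain p where p: "biinfinite_path G p" "x = lab \<circ> p"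
    unfolding label_sequences_def by blast
  obtain w where "awalk v w (tail G (p 0))" using awalk_exists base path_vertex[OF p(1)] by blast
  then have "x \<in> phase_sequences d (length w mod d)"
    using p unfolding phase_sequences_def by (auto simp: cong_def)
  then show "x \<in> (\<Union>i<d. phase_sequences d i)" using assms by auto
qed (auto simp: phase_sequences_def label_sequences_def)

section \<open>Phases modulo a common divisor of the return times, all of whose large multiples are
  return times\<close>

context
  fixes d M :: nat
  assumes d_pos: "d > 0"
    and dvd_return: "s \<in> return_times \<Longrightarrow> d dvd s"
    and multiple_return: "m \<ge> M \<Longrightarrow> d * m \<in> return_times"
begin

text \<open>Closing both walks with the same walk back to \<open>v\<close> gives two return times,
  both divisible by \<open>d\<close>. Hence the phase of a path is well defined.\<close>

lemma awalk_length_cong: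
  assumes "awalk v w u" "awalk v w' u"
  shows "[length w = length w'] (mod d)"
proof -
  obtain r where "awalk u r v" using awalk_exists base assms(1) awalk_last_in_verts by blast
  then have "awalk v (w @ r) v" "awalk v (w' @ r) v" using assms by (auto intro: awalk_appendI)
  then have "d dvd length (w @ r)" "d dvd length (w' @ r)"
    using dvd_return unfolding return_times_def by blast+
  then have "[length w + length r = length w' + length r] (mod d)"
    by (simp add: cong_def mod_eq_0_iff_dvd)
  then show ?thesis by (simp only: cong_add_rcancel_nat)
qed

lemma shift_phase_sequences: "shift ` phase_sequences d i = phase_sequences d (Suc i)"
proof (intro equalityI subsetI)
  fix x assume "x \<in> shift ` phase_sequences d i"
  then obtain p w where p: "biinfinite_path G p" "x = shift (lab \<circ> p)"
    and w: "awalk v w (tail G (p 0))" "[length w = i] (mod d)"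
    unfolding phase_sequences_def by blast
  obtain e where "awalk (tail G (p 0)) e (tail G (p 1))" "length e = 1"
    using biinfinite_path_awalk[OF p(1), of 0 1] by auto
  then have "awalk v (w @ e) (tail G (shift p 0))" "[length (w @ e) = Suc i] (mod d)"
    using w cong_add[OF w(2) cong_refl[of 1]] by (auto simp: shift_def intro: awalk_appendI)
  moreover have "biinfinite_path G (shift p)" "x = lab \<circ> shift p"
    using p by (auto simp: biinfinite_path_def shift_def)
  ultimately show "x \<in> phase_sequences d (Suc i)" unfolding phase_sequences_def by blast
next
  fix x assume "x \<in> phase_sequences d (Suc i)"
  then obtain p w where p: "biinfinite_path G p" "x = lab \<circ> p"
    and w: "awalk v w (tail G (p 0))" "[length w = Suc i] (mod d)"
    unfolding phase_sequences_def by blast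
  define q where "q = (\<lambda>i. p (i - 1))"
  have "head G (q i) = tail G (q (i + 1))" for i
    using p(1) unfolding biinfinite_path_def q_def by (metis add_diff_cancel diff_add_cancel)
  then have q: "biinfinite_path G q"
    using p(1) by (auto simp: biinfinite_path_def q_def)
  \<comment> \<open>Any walk to the earlier vertex will do: extended by one arc it ends where
    \<open>w\<close> ends, which determines its length modulo \<open>d\<close>.\<close>
  obtain u where u: "awalk v u (tail G (q 0))"
    using awalk_exists base path_vertex[OF q] by blast
  obtain e where "awalk (tail G (q 0)) e (tail G (p 0))" "length e = 1"
    using biinfinite_path_awalk[OF q, of 0 1] by (auto simp: q_def)
  then have "awalk v (u @ e) (tail G (p 0))" "length (u @ e) = Suc (length u)"
    using u by (auto intro: awalk_appendI)
  then have "[Suc (length u) = Suc i] (mod d)"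
    using awalk_length_cong w cong_trans by metis
  then have "[length u = i] (mod d)" using cong_add_rcancel_nat[of "length u" 1 i d] by simp
  then have "lab \<circ> q \<in> phase_sequences d i" using q u unfolding phase_sequences_def by blast
  moreover have "x = shift (lab \<circ> q)" using p(2) by (auto simp: shift_def q_def)
  ultimately show "x \<in> shift ` phase_sequences d i" by blast
qed

text \<open>The first path is followed through time \<open>N\<close>, then a detour through
  \<open>v\<close> leads to the second path at its time \<open>- N\<close>. Equal phases make the
  required delay divisible by \<open>d\<close>, and closed walks at \<open>v\<close> absorb any
  large multiple of \<open>d\<close>.\<close>

lemma phase_sequences_splice:
  assumes "x \<in> phase_sequences d i" "y \<in> phase_sequences d i"
  shows "\<exists>K. \<forall>m>K. \<exists>z\<in>phase_sequences d i.
    (\<forall>j. j \<le> int N \<longrightarrow> z j = x j) \<and> (\<forall>j. j \<ge> - int N \<longrightarrow> z (j + int (d * m)) = y j)"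
proof -
  obtain p w where p: "biinfinite_path G p" "x = lab \<circ> p"
    and w: "awalk v w (tail G (p 0))" "[length w = i] (mod d)"
    using assms(1) unfolding phase_sequences_def by blast
  obtain q w' where q: "biinfinite_path G q" "y = lab \<circ> q"
    and w': "awalk v w' (tail G (q 0))" "[length w' = i] (mod d)"
    using assms(2) unfolding phase_sequences_def by blast
  obtain c where c: "awalk (tail G (p (int N + 1))) c v"
    using awalk_exists base path_vertex[OF p(1)] by blast
  obtain a where a: "awalk v a (tail G (q (- int N)))"
    using awalk_exists base path_vertex[OF q(1)] by blast
  obtain e where e: "awalk (tail G (p 0)) e (tail G (p (int N + 1)))" "length e = N + 1"
    using biinfinite_path_awalk[OF p(1), of 0 "N + 1"] by (auto simp: add.commute)
  obtain f where f: "awalk (tail G (q (- int N))) f (tail G (q 0))" "length f = N"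
    using biinfinite_path_awalk[OF q(1), of "- int N" N] by auto
  \<comment> \<open>The delay when no closed walk is inserted at \<open>v\<close>: the detour
    \<open>c @ a\<close> together with the \<open>2 * N + 1\<close> positions of the window.\<close>
  define t where "t = length a + length c + 2 * N + 1"
  have "awalk v (w @ e @ c) v" using w e c by (auto intro: awalk_appendI)
  then have "length (w @ e @ c) \<in> return_times" unfolding return_times_def by blast
  then have "d dvd length w + (N + 1 + length c)"
    using dvd_return[of "length (w @ e @ c)"] e by simp
  then have "[length w + (N + 1 + length c) = 0] (mod d)" by (simp add: cong_0_iff)
  \<comment> \<open>Here the equality of phases enters: \<open>a @ f\<close> and \<open>w'\<close>
    end at the same vertex, and \<open>w'\<close> and \<open>w\<close> have congruent
    lengths.\<close>
  moreover have "[length a + N = length w] (mod d)"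
    using awalk_length_cong[of "a @ f" _ w'] awalk_appendI[OF a f(1)] w w' f(2)
    by (metis cong_sym cong_trans length_append)
  ultimately have "[length a + N + (N + 1 + length c) = 0] (mod d)"
    using cong_add cong_refl cong_trans by blast
  moreover have "length a + N + (N + 1 + length c) = t" unfolding t_def by simp
  ultimately have "d dvd t" by (simp add: cong_0_iff)
  then obtain k where k: "t = d * k" by blast
  have "\<exists>z\<in>phase_sequences d i.
    (\<forall>j. j \<le> int N \<longrightarrow> z j = x j) \<and> (\<forall>j. j \<ge> - int N \<longrightarrow> z (j + int (d * m)) = y j)"
    if m: "m > M + k" for m
  proof -
    have "d * (m - k) \<in> return_times" using m by (intro multiple_return) simp
    then obtain r where r: "awalk v r v" "length r = d * (m - k)"
      unfolding return_times_def by force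
    define g where "g = c @ r @ a"
    have g: "awalk (tail G (p (int N + 1))) g (tail G (q (- int N)))"
      unfolding g_def using c r a by (auto intro: awalk_appendI)
    have "m = k + (m - k)" using m by simp
    then have "d * m = t + d * (m - k)" using k by (metis add_mult_distrib2)
    then have lg: "int N + 1 + int (length g) = int (d * m) - int N"
      unfolding g_def t_def using r by simp
    obtain z where z: "biinfinite_path G z" "\<And>j. j < int N + 1 \<Longrightarrow> z j = p j"
      "\<And>j. j \<ge> 0 \<Longrightarrow> z (int N + 1 + int (length g) + j) = q (- int N + j)"
      using biinfinite_path_splice[OF p(1) q(1) g] by blast
    have "tail G (z 0) = tail G (p 0)" using z(2) by simp
    then have "awalk v w (tail G (z 0))" using w(1) by simp
    then have "lab \<circ> z \<in> phase_sequences d i"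
      using z(1) w(2) unfolding phase_sequences_def by blast
    moreover have "(lab \<circ> z) j = x j" if "j \<le> int N" for j
      using z(2) that p(2) by simp
    moreover have "(lab \<circ> z) (j + int (d * m)) = y j" if "j \<ge> - int N" for j
    proof -
      have "j + int (d * m) = int N + 1 + int (length g) + (j + int N)" using lg by linarith
      then have "z (j + int (d * m)) = q (- int N + (j + int N))"
        using z(3)[of "j + int N"] that by (simp only:)
      then show ?thesis using q(2) by simp
    qed
    ultimately show ?thesis by (intro bexI[of _ "lab \<circ> z"] conjI allI impI)
  qed
  then show ?thesis by (intro exI[of _ "M + k"] allI impI)
qed

text \<open>Non-empty open sets of the closure contain points of the phase itself. Splicing two such
  points over a window large enough for both sets gives the required orbit.\<close>

lemma mixing_phase_closure:
  "topologically_mixing (subtopology (full_shift A) (full_shift A closure_of phase_sequences d i))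
     (shift ^^ d)"
  unfolding topologically_mixing_def
proof (intro allI impI, elim conjE)
  let ?C = "full_shift A closure_of phase_sequences d i"
  have meets: "\<exists>O' x. openin (full_shift A) O' \<and> U = O' \<inter> ?C \<and> x \<in> O' \<and> x \<in> phase_sequences d i"
    if U: "openin (subtopology (full_shift A) ?C) U" "U \<noteq> {}" for U
  proof -
    obtain O' where O': "openin (full_shift A) O'" "U = O' \<inter> ?C"
      using U(1) unfolding openin_subtopology by blast
    then have "O' \<inter> phase_sequences d i \<noteq> {}"
      using U(2) openin_Int_closure_of_eq_empty[OF O'(1), of "phase_sequences d i"] by simp
    then obtain x where "x \<in> O'" "x \<in> phase_sequences d i" by blast
    then show ?thesis using O' by metis
  qed
  fix U V
  assume U: "openin (subtopology (full_shift A) ?C) U" "U \<noteq> {}"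
    and V: "openin (subtopology (full_shift A) ?C) V" "V \<noteq> {}"
  obtain U' x where U': "openin (full_shift A) U'" "U = U' \<inter> ?C" "x \<in> U'" "x \<in> phase_sequences d i"
    using meets[OF U] by blast
  obtain V' y where V': "openin (full_shift A) V'" "V = V' \<inter> ?C" "y \<in> V'" "y \<in> phase_sequences d i"
    using meets[OF V] by blast
  obtain N1 where N1: "\<And>z. range z \<subseteq> A \<Longrightarrow> (\<And>i. \<bar>i\<bar> \<le> int N1 \<Longrightarrow> z i = x i) \<Longrightarrow> z \<in> U'"
    using openin_full_shift_window[OF U'(1,3)] by blast
  obtain N2 where N2: "\<And>z. range z \<subseteq> A \<Longrightarrow> (\<And>i. \<bar>i\<bar> \<le> int N2 \<Longrightarrow> z i = y i) \<Longrightarrow> z \<in> V'"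
    using openin_full_shift_window[OF V'(1,3)] by blast
  obtain K where K: "\<forall>m>K. \<exists>z\<in>phase_sequences d i.
      (\<forall>j. j \<le> int (max N1 N2) \<longrightarrow> z j = x j) \<and>
      (\<forall>j. j \<ge> - int (max N1 N2) \<longrightarrow> z (j + int (d * m)) = y j)"
    using phase_sequences_splice[OF U'(4) V'(4), of "max N1 N2"] by (elim exE)
  have sub: "phase_sequences d i \<subseteq> ?C"
    by (rule closure_of_subset[OF phase_sequences_subset])
  have "((shift ^^ d) ^^ m) ` U \<inter> V \<noteq> {}" if m: "m > K" for m
  proof -
    obtain z where z: "z \<in> phase_sequences d i"
      "\<And>j. j \<le> int (max N1 N2) \<Longrightarrow> z j = x j"
      "\<And>j. j \<ge> - int (max N1 N2) \<Longrightarrow> z (j + int (d * m)) = y j"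
      using K m by metis
    have "z \<in> topspace (full_shift A)" using z(1) phase_sequences_subset[of d i] by blast
    then have rz: "range z \<subseteq> A" by (simp only: topspace_full_shift mem_Collect_eq)
    have zU: "z \<in> U" using U'(2) N1[OF rz] z sub by auto
    define z' where "z' = (shift ^^ (d * m)) z"
    have z': "z' = (\<lambda>j. z (j + int (d * m)))" unfolding z'_def by (rule funpow_shift)
    \<comment> \<open>A shift by a multiple of \<open>d\<close> preserves the phase, which puts
      \<open>z'\<close> in the closure and not just in \<open>V'\<close>.\<close>
    have "z' \<in> phase_sequences d (i + d * m)"
      using z(1) funpow_image_eq_shifted[of shift "phase_sequences d", OF shift_phase_sequences]
      unfolding z'_def by blast
    moreover have "phase_sequences d (i + d * m) = phase_sequences d i"
      unfolding phase_sequences_def by (simp add: cong_def)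
    ultimately have "z' \<in> phase_sequences d i" by simp
    moreover have "range z' \<subseteq> A" using rz unfolding z' by auto
    then have "z' \<in> V'" by (rule N2) (simp add: z' z(3) del: of_nat_mult)
    ultimately have "z' \<in> V" using V'(2) sub by auto
    then show ?thesis using zU unfolding z'_def funpow_mult by blast
  qed
  then show "\<exists>M. \<forall>m>M. ((shift ^^ d) ^^ m) ` U \<inter> V \<noteq> {}" by blast
qed

text \<open>Closure commutes with the finite union over phases and, \<open>shift\<close> being a
  homeomorphism, with the shift; so the relations between phases pass to their closures.\<close>

lemma mixing_cyclic_cover_phases:
  assumes ne: "label_sequences G lab \<noteq> {}"
  defines "X \<equiv> full_shift A closure_of label_sequences G lab"
  shows "mixing_cyclic_cover (subtopology (full_shift A) X) shift d
    (\<lambda>i. full_shift A closure_of phase_sequences d i)"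
proof -
  let ?C = "\<lambda>i. full_shift A closure_of phase_sequences d i"
  have cover: "(\<Union>i<d. ?C i) = X"
    unfolding X_def phase_sequences_cover[OF d_pos, symmetric] by (simp add: closure_of_Union image_image)
  have image: "shift ` ?C i = ?C (Suc i)" for i
    using homeomorphic_map_closure_of[OF homeomorphic_map_shift phase_sequences_subset]
      shift_phase_sequences by metis
  have mult: "phase_sequences d i = phase_sequences d (i mod d)" for i
    unfolding phase_sequences_def by (simp add: cong_def)
  have CX: "?C i \<subseteq> X" for i
    using cover d_pos mult[of i] by (metis UN_upper lessThan_iff mod_less_divisor)
  have XT: "X \<subseteq> topspace (full_shift A)" unfolding X_def by (rule closure_of_subset_topspace)
  have invariant: "shift ` X \<subseteq> X"
    unfolding cover[symmetric] image_UN image using CX cover by blast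
  show ?thesis
  proof
    show "continuous_map (subtopology (full_shift A) X) (subtopology (full_shift A) X) shift"
      using homeomorphic_imp_continuous_map[OF homeomorphic_map_shift] invariant
      by (auto simp: continuous_map_in_subtopology intro: continuous_map_from_subtopology)
    show "d > 0" by (rule d_pos)
    show "closedin (subtopology (full_shift A) X) (?C i)" for i
      using CX by (simp add: closedin_closed_subtopology X_def)
    show "shift ` ?C i = ?C (Suc i)" for i by (rule image)
    show "?C (i + d) = ?C i" for i by (simp only: phase_sequences_periodic)
    show "(\<Union>i<d. ?C i) = topspace (subtopology (full_shift A) X)" using cover XT by auto
    show "topologically_mixing (subtopology (subtopology (full_shift A) X) (?C i)) (shift ^^ d)" for i
      using mixing_phase_closure[of i] CX[of i] by (simp add: subtopology_subtopology Int_absorb1)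
    obtain k where k: "k < d" "phase_sequences d k \<noteq> {}"
      using ne phase_sequences_cover[OF d_pos] by blast
    show "?C i \<noteq> {}" for i
    proof -
      \<comment> \<open>This exponent carries the non-empty phase \<open>k\<close> to phase
        \<open>i + d\<close>, which is phase \<open>i\<close>, also when
        \<open>i < k\<close>.\<close>
      have "(shift ^^ (d - k + i)) ` phase_sequences d k = phase_sequences d (k + (d - k + i))"
        by (rule funpow_image_eq_shifted[of shift "phase_sequences d", OF shift_phase_sequences])
      moreover have "k + (d - k + i) = i + d" using k(1) by simp
      ultimately have "phase_sequences d i \<noteq> {}"
        using k(2) phase_sequences_periodic by (metis image_is_empty)
      then show ?thesis using closure_of_eq_empty[OF phase_sequences_subset] by blast
    qed
  qed
qed

end

theorem relatively_mixing_label_sequences: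
  assumes "label_sequences G lab \<noteq> {}"
  shows "relatively_mixing
    (subtopology (full_shift A) (full_shift A closure_of label_sequences G lab)) shift"
proof -
  obtain p where "biinfinite_path G p" using assms unfolding label_sequences_def by blast
  then obtain s where s: "s \<in> return_times" "s > 0" using return_times_positive by blast
  obtain d M where "d > 0" "\<And>s. s \<in> return_times \<Longrightarrow> d dvd s"
      "\<And>m. m \<ge> M \<Longrightarrow> d * m \<in> return_times"
    using submonoid_nat_eventually_multiples[OF return_times_zero return_times_add s] by blast
  then show ?thesis
    using mixing_cyclic_cover.relatively_mixing[OF mixing_cyclic_cover_phases] assms by blast
qed

end

theorem theorem3p3:
  fixes A :: "'a set" and X :: "(int \<Rightarrow> 'a) set"
  assumes "finite A" and "card A \<ge> 2"
    and "coded_system A X"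
  shows "relatively_mixing (subtopology (full_shift A) X) shift"
proof -
  obtain G :: "(nat, nat) pre_digraph" and lab where
    G: "countable_irreducible_labeled_graph A G lab" and
    X: "X = full_shift A closure_of label_sequences G lab" and ne: "X \<noteq> {}"
    using assms(3) by (auto simp: coded_system_def)
  obtain v where "v \<in> verts G"
    using G by (auto simp: countable_irreducible_labeled_graph_def strongly_connected_def)
  then interpret based_labeled_graph G A lab v
    using G by (auto simp: countable_irreducible_labeled_graph_def based_labeled_graph_def
        based_labeled_graph_axioms_def)
  \<comment> \<open>The closure of the empty set is empty, so \<open>X \<noteq> {}\<close> provides
    a bi-infinite path and thereby a positive return time.\<close>
  have "label_sequences G lab \<noteq> {}" using ne X by auto
  then show ?thesis using relatively_mixing_label_sequences X by simp
qed

end
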